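(* Let $b:\mathbb{R}^d\to\mathbb{R}^d$ be Lipschitz with constant $L_b>0$, i.e. $|b(x)-b(y)|\le L_b|x-y|$ for all $x,y\in\mathbb{R}^d$, and suppose there are constants $R,c,K>0$ such that for all $x,y\in\mathbb{R}^d$ $$\langle x-y,b(x)-b(y)\rangle\le\begin{cases}-c|x-y|^2&\text{if }|x|\ge R\text{ or }|y|\ge R,\\ K|x-y|^2&\text{otherwise.}\end{cases}$$ Then there exist $h,\delta_0,T_0>0$ and $M\ge1$ such that for all $\delta\in(0,\delta_0]$ and all $T\ge T_0$, the Markov kernel $Q$ of the Euler scheme $X_{k+1}=X_k+\delta b(X_k)+\sqrt{2T\delta}\,Z_{k+1}$ satisfies, for any $k\ge1$, $$\mathcal{W}_2(\mu Q^k,\nu Q^k)\le M(1-h\delta)^k\,\mathcal{W}_2(\mu,\nu)\qquad\text{for all }\mu,\nu\in\mathcal{P}(\mathbb{R}^d).$$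
   Context: $\mathcal{P}(\mathbb{R}^d)$ is the set of probability measures on $\mathbb{R}^d$ and $\mathcal{W}_2$ is the $L^2$-Wasserstein distance for the Euclidean distance, $\mathcal{W}_2(\mu,\nu)=\left(\inf_{\pi\in\Pi(\mu,\nu)}\int|x-y|^2d\pi(x,y)\right)^{1/2}$, with $\Pi(\mu,\nu)$ the set of couplings of $\mu$ and $\nu$. In the Euler scheme, $\delta>0$ is the discretisation parameter, $T>0$ the diffusivity parameter, and $(Z_k)_{k\ge1}$ are i.i.d. standard normal in $\mathbb{R}^d$. *)

theory Defs
  imports "HOL-Probability.Probability"
begin

definition couplings :: "'a::euclidean_space measure \<Rightarrow> 'a measure \<Rightarrow> ('a \<times> 'a) measure set" where
  "couplings \<mu> \<nu> = {\<pi> \<in> space (prob_algebra (borel \<Otimes>\<^sub>M borel)).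
     distr \<pi> borel fst = \<mu> \<and> distr \<pi> borel snd = \<nu>}"

definition transport_cost2 :: "'a::euclidean_space measure \<Rightarrow> 'a measure \<Rightarrow> ennreal" where
  "transport_cost2 \<mu> \<nu> =
     (INF \<pi>\<in>couplings \<mu> \<nu>. \<integral>\<^sup>+ (x, y). ennreal ((norm (x - y))\<^sup>2) \<partial>\<pi>)"

(* The distance may be infinite, since no second moments are assumed. It takes values in
   ereal rather than ennreal so that it can be multiplied by an arbitrary real factor
   without negative factors being truncated to 0. *)
definition wasserstein2 :: "'a::euclidean_space measure \<Rightarrow> 'a measure \<Rightarrow> ereal" where
  "wasserstein2 \<mu> \<nu> =
     (if transport_cost2 \<mu> \<nu> = \<infinity> then \<infinity>
      else ereal (sqrt (enn2real (transport_cost2 \<mu> \<nu>))))"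

definition std_normal :: "'a::euclidean_space measure" where
  "std_normal = density lborel (\<lambda>z. ennreal (\<Prod>i\<in>Basis. std_normal_density (z \<bullet> i)))"

(* Transition law of X' = X + \<delta> b(X) + sqrt(2 T \<delta>) Z from X = x. *)
definition euler_kernel ::
  "('a::euclidean_space \<Rightarrow> 'a) \<Rightarrow> real \<Rightarrow> real \<Rightarrow> 'a \<Rightarrow> 'a measure" where
  "euler_kernel b T \<delta> x =
     distr std_normal borel (\<lambda>z. x + \<delta> *\<^sub>R b x + sqrt (2 * T * \<delta>) *\<^sub>R z)"

(* The measure \<mu> Q^k, obtained by letting the kernel Q act k times on \<mu>. *)
definition kernel_iter ::
  "'a::euclidean_space measure \<Rightarrow> ('a \<Rightarrow> 'a measure) \<Rightarrow> nat \<Rightarrow> 'a measure" where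
  "kernel_iter \<mu> Q k = ((\<lambda>\<rho>. \<rho> \<bind> Q) ^^ k) \<mu>"

end

theory Submission
  imports Defs
begin

text \<open>
  Synchronous coupling with a weight. If both chains use the same noise, the squared distance is
  multiplied by at most \<open>1 - 3c\<delta>/2\<close> when the first chain is outside the ball of radius \<open>R\<close>, and by
  at most \<open>1 + (2K+1)\<delta>\<close> otherwise. It therefore suffices to find \<open>V\<close> with values in \<open>[1,2]\<close>
  such that the expectation of \<open>V\<close> after one step from \<open>x\<close> gains at most \<open>c\<delta>/2\<close> everywhere and
  drops by a prescribed multiple of \<open>\<delta>\<close> inside the ball: then \<open>V(x) |x - y|\<^sup>2\<close> contracts by \<open>1 - c\<delta>\<close>.
  Take \<open>V = 1 + A\<delta> \<Sum>\<^bsub>j<n\<^esub> g\<^sub>j\<close>, where \<open>g\<^sub>j\<close> is a Gaussian bump of height at most 1 and variance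
  proportional to \<open>R\<^sup>2 + jT\<delta>\<close>. The noise maps \<open>g\<^sub>j\<close> exactly to \<open>g\<^bsub>j+1\<^esub>\<close>, so the sum telescopes:
  the loss \<open>g\<^sub>0\<close> is bounded below on the ball, and the gain \<open>g\<^sub>n\<close> is small once \<open>nT\<delta>\<close> is a large
  multiple of \<open>R\<^sup>2\<close>. The drift costs \<open>O(\<delta>)\<close> per bump, hence \<open>A n \<delta> O(\<delta>)\<close> in total, and
  \<open>A n \<delta>\<close>, which is about \<open>A (N\<^sup>2 R\<^sup>2 / T + \<delta>)\<close> with \<open>N\<close> fixed, is small for large \<open>T\<close> and small \<open>\<delta>\<close>.
\<close>

section \<open>Gaussian bumps under the noise and under the drift\<close>

text \<open>Completing the square: the integrand is the claimed value times a normal density in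
  \<open>z\<close> with mean \<open>m\<close> and variance \<open>t / s\<close>, which integrates to
  1.\<close>

lemma nn_integral_std_normal_gaussian_1d:
  fixes t a \<sigma> :: real
  assumes t: "t > 0"
  defines "s \<equiv> t + \<sigma>\<^sup>2 / 2"
  shows "(\<integral>\<^sup>+z. ennreal (std_normal_density z * (1 / sqrt t * exp (- (a + \<sigma> * z)\<^sup>2 / (4 * t)))) \<partial>lborel)
       = ennreal (1 / sqrt s * exp (- a\<^sup>2 / (4 * s)))"
proof -
  have s: "s > 0" unfolding s_def using t by (intro add_pos_nonneg) auto
  define m where "m = - (a * \<sigma>) / (2 * s)"
  have eq: "std_normal_density z * (1 / sqrt t * exp (- (a + \<sigma> * z)\<^sup>2 / (4 * t)))
     = 1 / sqrt s * exp (- a\<^sup>2 / (4 * s)) * normal_density m (sqrt (t / s)) z" for z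
  proof -
    have sig: "\<sigma>\<^sup>2 = 2 * (s - t)" by (simp add: s_def)
    have "z\<^sup>2 / 2 + (a + \<sigma> * z)\<^sup>2 / (4 * t) - a\<^sup>2 / (4 * s) - (z - m)\<^sup>2 * s / (2 * t)
        = (4 * s * t * z\<^sup>2 + 2 * s * (a + \<sigma> * z)\<^sup>2 - 2 * t * a\<^sup>2 - (2 * s * z + a * \<sigma>)\<^sup>2) / (8 * s * t)"
      unfolding m_def using t s by (simp add: field_simps power2_eq_square)
    also have "4 * s * t * z\<^sup>2 + 2 * s * (a + \<sigma> * z)\<^sup>2 - 2 * t * a\<^sup>2 - (2 * s * z + a * \<sigma>)\<^sup>2
        = 4 * s * t * z\<^sup>2 + 2 * s * a\<^sup>2 + 2 * s * z\<^sup>2*\<sigma>\<^sup>2 - 2 * t * a\<^sup>2 - 4 * s\<^sup>2 * z\<^sup>2 - a\<^sup>2*\<sigma>\<^sup>2"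
      by (simp add: field_simps power2_eq_square)
    also have "\<dots> = 0" unfolding sig by (simp add: field_simps power2_eq_square)
    finally have exponent: "z\<^sup>2 / 2 + (a + \<sigma> * z)\<^sup>2 / (4 * t)
        = a\<^sup>2 / (4 * s) + (z - m)\<^sup>2 * s / (2 * t)" by simp
    have "std_normal_density z * (1 / sqrt t * exp (- (a + \<sigma> * z)\<^sup>2 / (4 * t)))
       = 1 / (sqrt (2 * pi) * sqrt t) * exp (- (z\<^sup>2 / 2 + (a + \<sigma> * z)\<^sup>2 / (4 * t)))"
      by (simp add: std_normal_density_def mult_exp_exp)
    also have "\<dots> = 1 / (sqrt (2 * pi) * sqrt t) * (exp (- a\<^sup>2 / (4 * s)) * exp (- (z - m)\<^sup>2 * s / (2 * t)))"
      unfolding exponent by (simp add: exp_add[symmetric])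
    also have "\<dots> = 1 / sqrt s * exp (- a\<^sup>2 / (4 * s)) * normal_density m (sqrt (t / s)) z"
      using t s by (simp add: normal_density_def real_sqrt_mult real_sqrt_divide power_divide)
    finally show ?thesis .
  qed
  interpret N: prob_space "density lborel (normal_density m (sqrt (t / s)))"
    by (rule prob_space_normal_density) (use t s in simp)
  have "(\<integral>\<^sup>+z. ennreal (normal_density m (sqrt (t / s)) z) \<partial>lborel) = 1"
    using N.emeasure_space_1 by (simp add: emeasure_density)
  moreover have "ennreal (1 / sqrt s * exp (- a\<^sup>2 / (4 * s)) * normal_density m (sqrt (t / s)) z)
      = ennreal (1 / sqrt s * exp (- a\<^sup>2 / (4 * s))) * ennreal (normal_density m (sqrt (t / s)) z)" for z
    using s by (intro ennreal_mult) auto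
  moreover have "(\<lambda>z. ennreal (normal_density m (sqrt (t / s)) z)) \<in> borel_measurable lborel"
    by simp
  ultimately show ?thesis
    unfolding eq by (simp only: nn_integral_cmult mult_1_right)
qed

text \<open>The heat kernel at time \<open>t\<close> (centred normal density with covariance
  \<open>2 * t\<close> times the identity), rescaled by a constant depending on \<open>r\<close> so
  that its peak has height 1 at \<open>t = r\<^sup>2\<close>.\<close>

definition gauss :: "real \<Rightarrow> real \<Rightarrow> 'a::euclidean_space \<Rightarrow> real" where
  "gauss r t x = (r / sqrt t) ^ DIM('a) * exp (- (norm x)\<^sup>2 / (4 * t))"

lemma gauss_eq_prod:
  fixes x :: "'a::euclidean_space"
  shows "gauss r t x = (\<Prod>i\<in>Basis. r * (1 / sqrt t * exp (- (x \<bullet> i)\<^sup>2 / (4 * t))))"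
proof -
  have "(norm x)\<^sup>2 = (\<Sum>i\<in>Basis. (x \<bullet> i)\<^sup>2)"
    by (subst euclidean_inner[of x x, folded power2_norm_eq_inner]) (simp add: power2_eq_square)
  then have "exp (- (norm x)\<^sup>2 / (4 * t)) = (\<Prod>i\<in>Basis. exp (- (x \<bullet> i)\<^sup>2 / (4 * t)))"
    by (simp add: exp_sum[symmetric] sum_negf sum_divide_distrib)
  then show ?thesis
    by (simp add: gauss_def prod.distrib prod_dividef power_divide)
qed

lemma gauss_measurable [measurable]: "gauss r t \<in> borel_measurable borel"
  unfolding gauss_def by measurable

lemma space_std_normal [simp]: "space std_normal = UNIV"
  and sets_std_normal [simp, measurable_cong]: "sets std_normal = sets borel"
  by (simp_all add: std_normal_def)

lemma nn_integral_std_normal_prod: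
  fixes f :: "'a::euclidean_space \<Rightarrow> real \<Rightarrow> real"
  assumes [measurable]: "\<And>i. f i \<in> borel_measurable borel" and nonneg: "\<And>i x. 0 \<le> f i x"
  shows "(\<integral>\<^sup>+z. ennreal (\<Prod>i\<in>Basis. f i (z \<bullet> i)) \<partial>(std_normal :: 'a measure))
       = (\<Prod>i\<in>Basis. \<integral>\<^sup>+z. ennreal (std_normal_density z * f i z) \<partial>lborel)"
proof -
  have "(\<integral>\<^sup>+z. ennreal (\<Prod>i\<in>Basis. f i (z \<bullet> i)) \<partial>(std_normal :: 'a measure))
      = (\<integral>\<^sup>+z. (\<Prod>i\<in>Basis. ennreal (std_normal_density (z \<bullet> i) * f i (z \<bullet> i))) \<partial>(lborel :: 'a measure))"
    unfolding std_normal_def using nonneg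
    by (subst nn_integral_density)
       (auto intro!: nn_integral_cong simp: prod_ennreal prod_nonneg ennreal_mult[symmetric] prod.distrib)
  also have "\<dots> = (\<Prod>i\<in>Basis. \<integral>\<^sup>+z. ennreal (std_normal_density z * f i z) \<partial>lborel)"
    by (rule nn_integral_lborel_prod) auto
  finally show ?thesis .
qed

lemma prob_space_std_normal: "prob_space (std_normal :: 'a::euclidean_space measure)"
proof
  interpret N: prob_space "density lborel std_normal_density"
    by (rule prob_space_normal_density) simp
  have "(\<integral>\<^sup>+z. ennreal (std_normal_density z) \<partial>lborel) = 1"
    using N.emeasure_space_1 by (simp add: emeasure_density)
  then show "emeasure (std_normal :: 'a measure) (space std_normal) = 1"
    using nn_integral_std_normal_prod[of "\<lambda>(i::'a) z. 1"] by simp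
qed

text \<open>Semigroup property of the heat kernel, one coordinate at a time: the noise only advances
  the time and leaves the normalisation \<open>r\<close> alone.\<close>

lemma nn_integral_gauss_std_normal:
  fixes m :: "'a::euclidean_space"
  assumes "t > 0" "r \<ge> 0"
  shows "(\<integral>\<^sup>+z. ennreal (gauss r t (m + \<sigma> *\<^sub>R z)) \<partial>std_normal) = ennreal (gauss r (t + \<sigma>\<^sup>2 / 2) m)"
proof -
  have "(\<integral>\<^sup>+z. ennreal (gauss r t (m + \<sigma> *\<^sub>R z)) \<partial>std_normal)
     = (\<Prod>i\<in>(Basis::'a set). \<integral>\<^sup>+z. ennreal (std_normal_density z *
         (r * (1 / sqrt t * exp (- (m \<bullet> i + \<sigma> * z)\<^sup>2 / (4 * t))))) \<partial>lborel)"
    unfolding gauss_eq_prod inner_add_left inner_scaleR_left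
    by (rule nn_integral_std_normal_prod) (use assms in auto)
  also have "\<dots> = (\<Prod>i\<in>(Basis::'a set). ennreal r * (\<integral>\<^sup>+z. ennreal (std_normal_density z *
         (1 / sqrt t * exp (- (m \<bullet> i + \<sigma> * z)\<^sup>2 / (4 * t)))) \<partial>lborel))"
    using assms
    by (intro prod.cong refl, subst nn_integral_cmult[symmetric])
       (auto intro!: nn_integral_cong simp: ennreal_mult[symmetric] mult_ac)
  also have "\<dots> = ennreal (gauss r (t + \<sigma>\<^sup>2 / 2) m)"
    unfolding nn_integral_std_normal_gaussian_1d[OF assms(1)] gauss_eq_prod
    using assms by (simp add: prod_ennreal ennreal_mult[symmetric])
  finally show ?thesis .
qed

lemma gauss_nonneg: "r \<ge> 0 \<Longrightarrow> t > 0 \<Longrightarrow> 0 \<le> gauss r t x"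
  by (simp add: gauss_def)

lemma gauss_le_tail:
  fixes x :: "'a::euclidean_space"
  assumes "r > 0" "N \<ge> 1" "t \<ge> N\<^sup>2 * r\<^sup>2"
  shows "gauss r t x \<le> 1 / N"
proof -
  have "0 < N\<^sup>2 * r\<^sup>2" using assms by simp
  then have t: "t > 0" using assms by linarith
  have "N * r \<le> sqrt t"
    using real_le_rsqrt[of "N * r" t] assms by (simp add: power_mult_distrib)
  then have le: "r / sqrt t \<le> 1 / N" using assms t by (simp add: field_simps)
  also have "\<dots> \<le> 1" using assms by simp
  \<comment> \<open>The base is at most 1 and the dimension at least 1, so a single factor already
    gives a bound free of the dimension.\<close>
  finally have "(r / sqrt t) ^ DIM('a) \<le> (r / sqrt t) ^ 1"
    using assms t DIM_positive by (intro power_decreasing) (auto simp: Suc_le_eq)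
  also have "\<dots> \<le> 1 / N" using le by simp
  finally have "(r / sqrt t) ^ DIM('a) * exp (- (norm x)\<^sup>2 / (4 * t)) \<le> 1 / N * 1"
    using assms t by (intro mult_mono) auto
  then show ?thesis by (simp add: gauss_def)
qed

text \<open>The radius is \<open>2 * r\<close> because the bump is evaluated after the drift, which
  may push a point out of the ball of radius \<open>r\<close>.\<close>

lemma gauss_ge_center:
  assumes "r > 0" "norm x \<le> 2 * r"
  shows "gauss r (r\<^sup>2) x \<ge> exp (- 1)"
proof -
  have "(norm x)\<^sup>2 \<le> (2 * r)\<^sup>2" using assms by (intro power_mono) auto
  then have "(norm x)\<^sup>2 / (4 * r\<^sup>2) \<le> 1" using assms by (simp add: power_mult_distrib)
  then show ?thesis using assms by (simp add: gauss_def)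
qed

text \<open>The displacement may grow linearly in \<open>norm x\<close>, so the exponents
  \<open>u\<close> and \<open>v\<close> may differ by an unbounded amount. But \<open>u - v\<close>
  is at most \<delta> times an affine function of \<open>v\<close>, and the factor
  \<open>exp (- v)\<close> tames it since \<open>v * exp (- v) \<le> 1\<close>.\<close>

lemma gauss_drift:
  fixes x m :: "'a::euclidean_space"
  assumes r: "r > 0" "t \<ge> r\<^sup>2" and \<delta>: "\<delta> > 0" "(2 * L + 1) * \<delta> \<le> 1 / 2" "L > 0" and \<beta>: "\<beta> \<ge> 0"
    and m: "norm (m - x) \<le> \<delta> * (L * norm x + \<beta>)"
  shows "gauss r t m - gauss r t x \<le> (2 * (2 * L + 1) + \<beta>\<^sup>2 / (2 * r\<^sup>2)) * \<delta>"
proof -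
  have "r\<^sup>2 > 0" using r by simp
  then have t: "t > 0" using r by linarith
  define v u \<eta> where "v = (norm m)\<^sup>2 / (4 * t)" and "u = (norm x)\<^sup>2 / (4 * t)"
    and "\<eta> = (2 * L + 1) * \<delta>"
  have v0: "v \<ge> 0" and u0: "u \<ge> 0" using t by (auto simp: v_def u_def)
  have "norm x - norm m \<le> \<delta> * (L * norm x + \<beta>)"
    using m norm_triangle_ineq2[of x m] by (simp add: norm_minus_commute)
  then have "norm x * (norm x - norm m) \<le> norm x * (\<delta> * (L * norm x + \<beta>))"
    by (intro mult_left_mono) auto
  moreover have "2 * (norm x * (norm x - norm m)) \<ge> (norm x)\<^sup>2 - (norm m)\<^sup>2"
    using zero_le_power2[of "norm x - norm m"] by (simp add: power2_eq_square algebra_simps)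
  \<comment> \<open>Young's inequality removes the mixed term; this is the extra 1 in
    \<open>2 * L + 1\<close>.\<close>
  moreover have "\<delta> * (2 * norm x * \<beta>) \<le> \<delta> * ((norm x)\<^sup>2 + \<beta>\<^sup>2)"
    using sum_squares_bound[of "norm x" \<beta>] \<delta> by (intro mult_left_mono) auto
  ultimately have sq: "(norm x)\<^sup>2 - (norm m)\<^sup>2 \<le> \<eta> * (norm x)\<^sup>2 + \<delta> * \<beta>\<^sup>2"
    unfolding \<eta>_def by (simp add: power2_eq_square algebra_simps)
  have "((norm x)\<^sup>2 - (norm m)\<^sup>2) / (4 * t) \<le> (\<eta> * (norm x)\<^sup>2 + \<delta> * \<beta>\<^sup>2) / (4 * t)"
    using sq t by (intro divide_right_mono) auto
  \<comment> \<open>Here \<open>t\<close> disappears, so that one bound serves all bumps of the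
    weight.\<close>
  moreover have "\<delta> * \<beta>\<^sup>2 / (4 * t) \<le> \<delta> * \<beta>\<^sup>2 / (4 * r\<^sup>2)"
    using r \<delta> t by (intro divide_left_mono) (auto intro!: mult_pos_pos)
  ultimately have uv: "u - v \<le> \<eta> * u + \<delta> * \<beta>\<^sup>2 / (4 * r\<^sup>2)"
    by (simp add: u_def v_def diff_divide_distrib add_divide_distrib)
  \<comment> \<open>Absorbing half of \<open>u\<close> bounds \<open>u\<close> by \<open>v\<close>,
    the variable that the damping factor \<open>exp (- v)\<close> controls.\<close>
  have "\<eta> * u \<le> 1/2 * u" using \<delta> u0 unfolding \<eta>_def by (intro mult_right_mono) auto
  with uv have u_le: "u \<le> 2 * v + \<delta> * \<beta>\<^sup>2 / (2 * r\<^sup>2)" by simp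
  have e0: "\<eta> \<ge> 0" "\<eta> \<le> 1/2" using \<delta> by (auto simp: \<eta>_def)
  have b0: "\<delta> * \<beta>\<^sup>2 / (2 * r\<^sup>2) \<ge> 0" using \<delta> by simp
  have "\<eta> * u \<le> \<eta> * (2 * v) + \<eta> * (\<delta> * \<beta>\<^sup>2 / (2 * r\<^sup>2))"
    using mult_left_mono[OF u_le e0(1)] by (simp add: algebra_simps)
  also have "\<dots> \<le> \<eta> * (2 * v) + 1/2 * (\<delta> * \<beta>\<^sup>2 / (2 * r\<^sup>2))"
    using mult_right_mono[OF e0(2) b0] by simp
  finally have diff: "u - v \<le> 2 * \<eta> * v + \<delta> * \<beta>\<^sup>2 / (2 * r\<^sup>2)" using uv by simp
  have "exp (- v) * (1 + (v - u)) \<le> exp (- v) * exp (v - u)"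
    by (intro mult_left_mono exp_ge_add_one_self) auto
  then have "exp (- v) - exp (- u) \<le> exp (- v) * (u - v)"
    by (simp add: mult_exp_exp algebra_simps)
  also have "\<dots> \<le> exp (- v) * (2 * \<eta> * v + \<delta> * \<beta>\<^sup>2 / (2 * r\<^sup>2))"
    using diff by (intro mult_left_mono) auto
  also have "\<dots> = 2 * \<eta> * (v * exp (- v)) + \<delta> * \<beta>\<^sup>2 / (2 * r\<^sup>2) * exp (- v)"
    by (simp add: algebra_simps)
  also have "\<dots> \<le> 2 * \<eta> * 1 + \<delta> * \<beta>\<^sup>2 / (2 * r\<^sup>2) * 1"
  proof (intro add_mono mult_left_mono)
    have "v \<le> exp v" using exp_ge_add_one_self[of v] by linarith
    then show "v * exp (- v) \<le> 1" by (simp add: exp_minus field_simps)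
  qed (use e0 b0 v0 in auto)
  finally have ex: "exp (- v) - exp (- u) \<le> 2 * \<eta> + \<delta> * \<beta>\<^sup>2 / (2 * r\<^sup>2)" by simp
  define p where "p = (r / sqrt t) ^ DIM('a)"
  have "r \<le> sqrt t" using r real_le_rsqrt by blast
  then have p: "0 \<le> p" "p \<le> 1" using r t by (auto simp: p_def intro!: power_le_one)
  have "gauss r t m - gauss r t x = p * (exp (- v) - exp (- u))"
    by (simp add: gauss_def p_def u_def v_def algebra_simps)
  also have "\<dots> \<le> p * (2 * \<eta> + \<delta> * \<beta>\<^sup>2 / (2 * r\<^sup>2))"
    using ex p by (intro mult_left_mono)
  also have "\<dots> \<le> 1 * (2 * \<eta> + \<delta> * \<beta>\<^sup>2 / (2 * r\<^sup>2))"
    using p e0 b0 by (intro mult_right_mono) auto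
  finally show ?thesis by (simp add: \<eta>_def algebra_simps)
qed

section \<open>The weight and its expected change in one Euler step\<close>

text \<open>
  A truncated resolvent of the driftless walk with Gaussian increments of variance \<^term>\<open>2 * \<tau>\<close>:
  one step of that walk shifts the sum by one index.
\<close>
definition weight :: "real \<Rightarrow> real \<Rightarrow> real \<Rightarrow> nat \<Rightarrow> 'a::euclidean_space \<Rightarrow> real" where
  "weight a r \<tau> n x = 1 + a * (\<Sum>j<n. gauss r (r\<^sup>2 + real j * \<tau>) x)"

lemma weight_measurable [measurable]: "weight a r \<tau> n \<in> borel_measurable borel"
  unfolding weight_def by measurable

lemma weight_bounds:
  assumes "a \<ge> 0" "r > 0" "\<tau> \<ge> 0"
  shows "1 \<le> weight a r \<tau> n x" and "weight a r \<tau> n x \<le> 1 + a * real n"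
proof -
  have "r\<^sup>2 > 0" using assms by simp
  then have t: "r\<^sup>2 + real j * \<tau> > 0" "r\<^sup>2 + real j * \<tau> \<ge> r\<^sup>2" for j
    using assms by (auto intro!: add_pos_nonneg)
  have "(\<Sum>j<n. gauss r (r\<^sup>2 + real j * \<tau>) x) \<ge> 0"
    using t assms by (intro sum_nonneg gauss_nonneg) auto
  then show "1 \<le> weight a r \<tau> n x" using assms by (simp add: weight_def)
  have "(\<Sum>j<n. gauss r (r\<^sup>2 + real j * \<tau>) x) \<le> (\<Sum>j<n. 1)"
    \<comment> \<open>With \<open>N = 1\<close> the tail bound says that every bump has height at
      most 1.\<close>
    using gauss_le_tail[OF \<open>r > 0\<close>, of 1 "r\<^sup>2 + real j * \<tau>" x for j] t by (intro sum_mono) simp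
  then show "weight a r \<tau> n x \<le> 1 + a * real n"
    using assms by (simp add: weight_def mult_left_mono)
qed

text \<open>The noise advances the time of each bump by exactly the spacing \<open>\<tau>\<close>.
  Indices \<open>0\<close> to \<open>n - 1\<close> become \<open>1\<close> to \<open>n\<close>, so
  only the two end terms change.\<close>

lemma nn_integral_weight_std_normal:
  fixes m :: "'a::euclidean_space"
  assumes "a \<ge> 0" "r > 0" "\<tau> \<ge> 0" "\<sigma>\<^sup>2 = 2 * \<tau>"
  shows "(\<integral>\<^sup>+z. ennreal (weight a r \<tau> n (m + \<sigma> *\<^sub>R z)) \<partial>std_normal)
     = ennreal (weight a r \<tau> n m - a * gauss r (r\<^sup>2) m + a * gauss r (r\<^sup>2 + real n * \<tau>) m)"
proof -
  interpret prob_space "std_normal :: 'a measure" by (rule prob_space_std_normal)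
  have "r\<^sup>2 > 0" using assms by simp
  then have t: "r\<^sup>2 + real j * \<tau> > 0" for j
    using assms by (auto intro!: add_pos_nonneg)
  have nn: "gauss r (r\<^sup>2 + real j * \<tau>) y \<ge> 0" for j and y :: 'a
    using t assms by (intro gauss_nonneg) auto
  have "(\<integral>\<^sup>+z. ennreal (weight a r \<tau> n (m + \<sigma> *\<^sub>R z)) \<partial>std_normal)
     = (\<integral>\<^sup>+z. 1 + ennreal a * (\<Sum>j<n. ennreal (gauss r (r\<^sup>2 + real j * \<tau>) (m + \<sigma> *\<^sub>R z))) \<partial>std_normal)"
    unfolding weight_def using assms nn
    by (intro nn_integral_cong) (simp add: sum_nonneg ennreal_plus ennreal_mult del: ennreal_plus[symmetric])
  also have "\<dots> = 1 + ennreal a * (\<Sum>j<n. \<integral>\<^sup>+z. ennreal (gauss r (r\<^sup>2 + real j * \<tau>) (m + \<sigma> *\<^sub>R z)) \<partial>std_normal)"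
    by (simp add: nn_integral_add nn_integral_cmult nn_integral_sum emeasure_space_1[simplified])
  also have "\<dots> = 1 + ennreal a * (\<Sum>j<n. ennreal (gauss r (r\<^sup>2 + real (Suc j) * \<tau>) m))"
    using t assms by (simp add: nn_integral_gauss_std_normal algebra_simps)
  also have "\<dots> = ennreal (1 + a * (\<Sum>j<n. gauss r (r\<^sup>2 + real (Suc j) * \<tau>) m))"
    using assms nn by (simp add: sum_nonneg ennreal_plus ennreal_mult del: of_nat_Suc)
  also have "(\<Sum>j<n. gauss r (r\<^sup>2 + real (Suc j) * \<tau>) m)
      = (\<Sum>j<n. gauss r (r\<^sup>2 + real j * \<tau>) m) - gauss r (r\<^sup>2) m + gauss r (r\<^sup>2 + real n * \<tau>) m"
    using sum_lessThan_telescope[of "\<lambda>j. gauss r (r\<^sup>2 + real j * \<tau>) m" n]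
    by (simp add: sum_subtractf del: of_nat_Suc)
  finally show ?thesis by (simp add: weight_def algebra_simps)
qed

text \<open>The left-hand side is the expectation just computed, with \<open>m\<close> the position
  after the drift. Returning from \<open>m\<close> to \<open>x\<close> costs the drift bound once
  per bump, the last bump is at most \<open>1 / N\<close>, and the first is at least
  \<open>exp (- 1)\<close> at \<open>m\<close> when \<open>x\<close> is in the ball.\<close>

lemma weight_step_bound:
  fixes x m :: "'a::euclidean_space"
  assumes r: "r > 0" and \<delta>: "\<delta> > 0" "(2 * L + 1) * \<delta> \<le> 1 / 2" "L > 0" "\<beta> \<ge> 0" "\<delta> * (L * r + \<beta>) \<le> r"
    and m: "norm (m - x) \<le> \<delta> * (L * norm x + \<beta>)"
    and a: "a \<ge> 0" and \<tau>: "\<tau> > 0" and N: "N \<ge> 1" "real n * \<tau> \<ge> N\<^sup>2 * r\<^sup>2"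
  shows "weight a r \<tau> n m - a * gauss r (r\<^sup>2) m + a * gauss r (r\<^sup>2 + real n * \<tau>) m
     \<le> weight a r \<tau> n x + a * real n * ((2 * (2 * L + 1) + \<beta>\<^sup>2 / (2 * r\<^sup>2)) * \<delta>) + a / N
       - (if norm x < r then a * exp (- 1) else 0)"
proof -
  let ?C = "(2 * (2 * L + 1) + \<beta>\<^sup>2 / (2 * r\<^sup>2)) * \<delta>"
  have "(\<Sum>j<n. gauss r (r\<^sup>2 + real j * \<tau>) m) \<le> (\<Sum>j<n. gauss r (r\<^sup>2 + real j * \<tau>) x + ?C)"
  proof (intro sum_mono)
    fix j
    have "r\<^sup>2 + real j * \<tau> \<ge> r\<^sup>2" using \<tau> by simp
    from gauss_drift[OF r this \<delta>(1-4) m]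
    show "gauss r (r\<^sup>2 + real j * \<tau>) m \<le> gauss r (r\<^sup>2 + real j * \<tau>) x + ?C" by simp
  qed
  also have "\<dots> = (\<Sum>j<n. gauss r (r\<^sup>2 + real j * \<tau>) x) + real n * ?C"
    by (simp add: sum.distrib)
  finally have "a * (\<Sum>j<n. gauss r (r\<^sup>2 + real j * \<tau>) m)
       \<le> a * ((\<Sum>j<n. gauss r (r\<^sup>2 + real j * \<tau>) x) + real n * ?C)"
    using a by (rule mult_left_mono)
  then have w: "weight a r \<tau> n m \<le> weight a r \<tau> n x + a * real n * ?C"
    unfolding weight_def by (simp add: distrib_left mult.assoc)
  have "gauss r (r\<^sup>2 + real n * \<tau>) m \<le> 1 / N"
    using N by (intro gauss_le_tail r) (auto intro: add_increasing)
  then have tail: "a * gauss r (r\<^sup>2 + real n * \<tau>) m \<le> a / N"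
    using mult_left_mono[OF _ a] by fastforce
  have center: "(if norm x < r then a * exp (- 1) else 0) \<le> a * gauss r (r\<^sup>2) m"
  proof (cases "norm x < r")
    case True
    have "norm m \<le> norm x + norm (m - x)" using norm_triangle_ineq[of x "m - x"] by simp
    also have "\<dots> \<le> r + \<delta> * (L * r + \<beta>)"
      using True \<delta> by (intro add_mono order_trans[OF m] mult_left_mono) auto
    finally have "norm m \<le> 2 * r" using \<delta> by simp
    from gauss_ge_center[OF r this] True a show ?thesis by (simp add: mult_left_mono)
  next
    case False
    then show ?thesis using a r gauss_nonneg[of r "r\<^sup>2" m] by simp
  qed
  show ?thesis using w tail center by linarith
qed

section \<open>Synchronous coupling of two Euler chains\<close>

lemma std_normal_in_prob_algebra: "(std_normal :: 'a::euclidean_space measure) \<in> space (prob_algebra borel)"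
  by (simp add: space_prob_algebra prob_space_std_normal)

lemma euler_kernel_measurable:
  fixes b :: "'a::euclidean_space \<Rightarrow> 'a"
  assumes [measurable]: "b \<in> borel_measurable borel"
  shows "euler_kernel b T \<delta> \<in> borel \<rightarrow>\<^sub>M prob_algebra borel"
  unfolding euler_kernel_def[abs_def]
proof (rule measurable_distr_prob_space2)
  show "(\<lambda>x. std_normal) \<in> borel \<rightarrow>\<^sub>M prob_algebra borel"
    by (intro measurable_const std_normal_in_prob_algebra)
qed measurable

text \<open>The noise is an explicit argument, so that two chains can be fed the same value.\<close>

definition euler_map :: "('a::euclidean_space \<Rightarrow> 'a) \<Rightarrow> real \<Rightarrow> real \<Rightarrow> 'a \<Rightarrow> 'a \<Rightarrow> 'a" where
  "euler_map b T \<delta> x z = x + \<delta> *\<^sub>R b x + sqrt (2 * T * \<delta>) *\<^sub>R z"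

definition sync_kernel ::
  "('a::euclidean_space \<Rightarrow> 'a) \<Rightarrow> real \<Rightarrow> real \<Rightarrow> 'a \<times> 'a \<Rightarrow> ('a \<times> 'a) measure" where
  "sync_kernel b T \<delta> p =
     distr std_normal (borel \<Otimes>\<^sub>M borel) (\<lambda>z. (euler_map b T \<delta> (fst p) z, euler_map b T \<delta> (snd p) z))"

lemma euler_map_measurable [measurable (raw)]:
  assumes [measurable]: "b \<in> borel_measurable borel" "f \<in> borel_measurable M" "g \<in> borel_measurable M"
  shows "(\<lambda>x. euler_map b T \<delta> (f x) (g x)) \<in> borel_measurable M"
  unfolding euler_map_def by measurable

lemma sync_kernel_measurable:
  fixes b :: "'a::euclidean_space \<Rightarrow> 'a"
  assumes [measurable]: "b \<in> borel_measurable borel"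
  shows "sync_kernel b T \<delta> \<in> borel \<Otimes>\<^sub>M borel \<rightarrow>\<^sub>M prob_algebra (borel \<Otimes>\<^sub>M borel)"
  unfolding sync_kernel_def[abs_def]
proof (rule measurable_distr_prob_space2)
  show "(\<lambda>x. std_normal) \<in> borel \<Otimes>\<^sub>M borel \<rightarrow>\<^sub>M prob_algebra borel"
    by (intro measurable_const std_normal_in_prob_algebra)
qed measurable

text \<open>Taking a marginal commutes with \<open>bind\<close>, and each marginal of
  \<open>P p\<close> depends only on the matching coordinate of \<open>p\<close>; so the projected
  law is that marginal of \<open>\<pi>\<close> followed by \<open>Q\<close>.\<close>

lemma bind_in_couplings:
  fixes Q :: "'a::euclidean_space \<Rightarrow> 'a measure"
  assumes \<pi>: "\<pi> \<in> couplings \<mu> \<nu>"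
    and Q: "Q \<in> borel \<rightarrow>\<^sub>M prob_algebra borel"
    and P: "P \<in> borel \<Otimes>\<^sub>M borel \<rightarrow>\<^sub>M prob_algebra (borel \<Otimes>\<^sub>M borel)"
    and fst_P: "\<And>p. distr (P p) borel fst = Q (fst p)"
    and snd_P: "\<And>p. distr (P p) borel snd = Q (snd p)"
  shows "\<pi> \<bind> P \<in> couplings (\<mu> \<bind> Q) (\<nu> \<bind> Q)"
proof -
  have \<pi>_alg: "\<pi> \<in> space (prob_algebra (borel \<Otimes>\<^sub>M borel))"
    and marg: "distr \<pi> borel fst = \<mu>" "distr \<pi> borel snd = \<nu>"
    using \<pi> by (auto simp: couplings_def)
  then have sets_\<pi> [measurable_cong]: "sets \<pi> = sets (borel \<Otimes>\<^sub>M borel)"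
    and "prob_space \<pi>" by (auto simp: space_prob_algebra)
  then have ne: "space \<pi> \<noteq> {}" using prob_space.not_empty by blast
  have P': "P \<in> \<pi> \<rightarrow>\<^sub>M subprob_algebra (borel \<Otimes>\<^sub>M borel)"
    using measurable_prob_algebraD[OF P] by (simp cong: measurable_cong_sets)
  have f: "fst \<in> \<pi> \<rightarrow>\<^sub>M borel" "snd \<in> \<pi> \<rightarrow>\<^sub>M borel" by measurable
  note Q' = measurable_prob_algebraD[OF Q]
  have "distr (\<pi> \<bind> P) borel fst = \<mu> \<bind> Q"
    using bind_distr[OF f(1) Q' ne] by (simp add: distr_bind[OF P' ne] fst_P marg)
  moreover have "distr (\<pi> \<bind> P) borel snd = \<nu> \<bind> Q"
    using bind_distr[OF f(2) Q' ne] by (simp add: distr_bind[OF P' ne] snd_P marg)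
  moreover have "\<pi> \<bind> P \<in> space (prob_algebra (borel \<Otimes>\<^sub>M borel))"
    using prob_space_bind'[OF \<pi>_alg P] sets_bind'[OF \<pi>_alg P] by (simp add: space_prob_algebra)
  ultimately show ?thesis by (simp add: couplings_def)
qed

lemma sync_kernel_marginals:
  fixes b :: "'a::euclidean_space \<Rightarrow> 'a"
  assumes [measurable]: "b \<in> borel_measurable borel"
  shows "distr (sync_kernel b T \<delta> p) borel fst = euler_kernel b T \<delta> (fst p)"
    and "distr (sync_kernel b T \<delta> p) borel snd = euler_kernel b T \<delta> (snd p)"
  unfolding sync_kernel_def
  by (subst distr_distr; simp add: comp_def euler_kernel_def euler_map_def)+

section \<open>From one weighted step to the transport cost and the Wasserstein distance\<close>

text \<open>From any starting coupling, the synchronous coupling contracts the weighted cost by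
  \<open>\<theta>\<close> per step. The weight is removed at the end by \<open>V \<ge> 1\<close> and
  at the start by \<open>V \<le> M\<close>; the infimum over starting couplings comes last.\<close>

lemma transport_cost2_iter_le:
  fixes b :: "'a::euclidean_space \<Rightarrow> 'a" and V :: "'a \<Rightarrow> real"
  assumes b [measurable]: "b \<in> borel_measurable borel" and V [measurable]: "V \<in> borel_measurable borel"
    and V_bounds: "\<And>x. 1 \<le> V x" "\<And>x. V x \<le> M"
    and \<theta>: "\<theta> > 0"
    and step: "\<And>x y. (\<integral>\<^sup>+z. ennreal (V (euler_map b T \<delta> x z)) \<partial>std_normal)
        * ennreal ((norm (x + \<delta> *\<^sub>R b x - (y + \<delta> *\<^sub>R b y)))\<^sup>2)
      \<le> ennreal \<theta> * (ennreal (V x) * ennreal ((norm (x - y))\<^sup>2))"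
  shows "transport_cost2 (kernel_iter \<mu> (euler_kernel b T \<delta>) k) (kernel_iter \<nu> (euler_kernel b T \<delta>) k)
    \<le> ennreal (M * \<theta> ^ k) * transport_cost2 \<mu> \<nu>"
proof -
  let ?Q = "euler_kernel b T \<delta>" and ?P = "sync_kernel b T \<delta>"
  define cost where "cost p = ennreal (V (fst p)) * ennreal ((norm (fst p - snd p))\<^sup>2)" for p :: "'a \<times> 'a"
  have cost_meas [measurable]: "cost \<in> borel_measurable (borel \<Otimes>\<^sub>M borel)"
    unfolding cost_def[abs_def] by measurable
  have M: "M \<ge> 1" using order_trans[OF V_bounds] .
  have cost_step: "(\<integral>\<^sup>+q. cost q \<partial>?P p) \<le> ennreal \<theta> * cost p" for p
  proof -
    obtain x y where p: "p = (x, y)" by (cases p)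
    \<comment> \<open>The common noise cancels, so the new distance is deterministic and leaves the
      integral.\<close>
    have diff: "euler_map b T \<delta> x z - euler_map b T \<delta> y z = x + \<delta> *\<^sub>R b x - (y + \<delta> *\<^sub>R b y)" for z
      by (simp add: euler_map_def)
    have "(\<integral>\<^sup>+q. cost q \<partial>?P p) = (\<integral>\<^sup>+z. cost (euler_map b T \<delta> x z, euler_map b T \<delta> y z) \<partial>std_normal)"
      unfolding sync_kernel_def p by (subst nn_integral_distr) auto
    also have "\<dots> = (\<integral>\<^sup>+z. ennreal (V (euler_map b T \<delta> x z)) \<partial>std_normal)
        * ennreal ((norm (x + \<delta> *\<^sub>R b x - (y + \<delta> *\<^sub>R b y)))\<^sup>2)"
      unfolding cost_def fst_conv snd_conv diff by (subst nn_integral_multc) auto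
    also have "\<dots> \<le> ennreal \<theta> * cost p" using step[of x y] by (simp add: cost_def p)
    finally show ?thesis .
  qed
  have iter: "\<exists>\<pi>'\<in>couplings (kernel_iter \<mu> ?Q k) (kernel_iter \<nu> ?Q k).
      (\<integral>\<^sup>+q. cost q \<partial>\<pi>') \<le> ennreal (\<theta> ^ k) * (\<integral>\<^sup>+q. cost q \<partial>\<pi>)" if \<pi>: "\<pi> \<in> couplings \<mu> \<nu>" for \<pi>
  proof (induction k)
    case 0
    show ?case using \<pi> by (intro bexI[of _ \<pi>]) (auto simp: kernel_iter_def)
  next
    case (Suc k)
    then obtain \<pi>' where \<pi>': "\<pi>' \<in> couplings (kernel_iter \<mu> ?Q k) (kernel_iter \<nu> ?Q k)"
      and le: "(\<integral>\<^sup>+q. cost q \<partial>\<pi>') \<le> ennreal (\<theta> ^ k) * (\<integral>\<^sup>+q. cost q \<partial>\<pi>)" by blast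
    have sets_\<pi>' [measurable_cong]: "sets \<pi>' = sets (borel \<Otimes>\<^sub>M borel)"
      using \<pi>' by (auto simp: couplings_def space_prob_algebra)
    have "\<pi>' \<bind> ?P \<in> couplings (kernel_iter \<mu> ?Q (Suc k)) (kernel_iter \<nu> ?Q (Suc k))"
      using bind_in_couplings[OF \<pi>' euler_kernel_measurable[OF b] sync_kernel_measurable[OF b]
          sync_kernel_marginals[OF b]] by (simp add: kernel_iter_def)
    moreover have "(\<integral>\<^sup>+q. cost q \<partial>(\<pi>' \<bind> ?P)) = (\<integral>\<^sup>+p. \<integral>\<^sup>+q. cost q \<partial>?P p \<partial>\<pi>')"
      using measurable_prob_algebraD[OF sync_kernel_measurable[OF b]]
      by (intro nn_integral_bind[OF cost_meas]) (simp cong: measurable_cong_sets)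
    moreover have "\<dots> \<le> (\<integral>\<^sup>+p. ennreal \<theta> * cost p \<partial>\<pi>')"
      by (intro nn_integral_mono cost_step)
    moreover have "\<dots> = ennreal \<theta> * (\<integral>\<^sup>+p. cost p \<partial>\<pi>')"
      by (rule nn_integral_cmult) measurable
    moreover have "\<dots> \<le> ennreal \<theta> * (ennreal (\<theta> ^ k) * (\<integral>\<^sup>+q. cost q \<partial>\<pi>))"
      using le by (rule mult_left_mono) simp
    moreover have "\<dots> = ennreal (\<theta> ^ Suc k) * (\<integral>\<^sup>+q. cost q \<partial>\<pi>)"
      using \<theta> by (simp add: ennreal_mult mult.assoc)
    ultimately show ?case by (intro bexI[of _ "\<pi>' \<bind> ?P"]) auto
  qed
  let ?c = "\<lambda>\<pi>. \<integral>\<^sup>+(x, y). ennreal ((norm (x - y))\<^sup>2) \<partial>\<pi>"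
  let ?W = "transport_cost2 (kernel_iter \<mu> ?Q k) (kernel_iter \<nu> ?Q k)"
  have bound: "?W \<le> ennreal (M * \<theta> ^ k) * ?c \<pi>" if \<pi>: "\<pi> \<in> couplings \<mu> \<nu>" for \<pi>
  proof -
    obtain \<pi>' where \<pi>': "\<pi>' \<in> couplings (kernel_iter \<mu> ?Q k) (kernel_iter \<nu> ?Q k)"
      and le: "(\<integral>\<^sup>+q. cost q \<partial>\<pi>') \<le> ennreal (\<theta> ^ k) * (\<integral>\<^sup>+q. cost q \<partial>\<pi>)" using iter[OF \<pi>] by blast
    have [measurable_cong]: "sets \<pi> = sets (borel \<Otimes>\<^sub>M borel)"
      using \<pi> by (auto simp: couplings_def space_prob_algebra)
    have "?W \<le> ?c \<pi>'" unfolding transport_cost2_def by (rule INF_lower[OF \<pi>'])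
    also have "\<dots> \<le> (\<integral>\<^sup>+q. cost q \<partial>\<pi>')"
    proof (intro nn_integral_mono)
      fix q :: "'a \<times> 'a"
      have "1 * ennreal ((norm (fst q - snd q))\<^sup>2) \<le> cost q"
        unfolding cost_def using V_bounds(1) by (intro mult_right_mono) auto
      then show "(case q of (x, y) \<Rightarrow> ennreal ((norm (x - y))\<^sup>2)) \<le> cost q"
        by (simp add: case_prod_beta)
    qed
    also note le
    finally have W_le: "?W \<le> ennreal (\<theta> ^ k) * (\<integral>\<^sup>+q. cost q \<partial>\<pi>)" .
    have "(\<integral>\<^sup>+q. cost q \<partial>\<pi>) \<le> (\<integral>\<^sup>+q. ennreal M * (case q of (x, y) \<Rightarrow> ennreal ((norm (x - y))\<^sup>2)) \<partial>\<pi>)"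
      unfolding cost_def case_prod_beta
      using V_bounds(2) by (intro nn_integral_mono mult_right_mono ennreal_leI) auto
    also have "\<dots> = ennreal M * ?c \<pi>"
      by (rule nn_integral_cmult) measurable
    finally have "ennreal (\<theta> ^ k) * (\<integral>\<^sup>+q. cost q \<partial>\<pi>) \<le> ennreal (\<theta> ^ k) * (ennreal M * ?c \<pi>)"
      by (rule mult_left_mono) simp
    also have "\<dots> = ennreal (M * \<theta> ^ k) * ?c \<pi>"
      using \<theta> M by (simp add: ennreal_mult mult_ac)
    finally show ?thesis using W_le by simp
  qed
  \<comment> \<open>The positive factor is divided out first, so that the bounds for single
    couplings give a lower bound of the infimum.\<close>
  define C where "C = M * \<theta> ^ k"
  have C: "C > 0" using \<theta> M by (simp add: C_def)
  then have inv: "ennreal (1 / C) * (ennreal C * X) = X" for X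
    by (simp add: mult.assoc[symmetric] ennreal_mult[symmetric])
  have "ennreal (1 / C) * ?W \<le> transport_cost2 \<mu> \<nu>"
    unfolding transport_cost2_def[of \<mu> \<nu>]
  proof (rule INF_greatest)
    fix \<pi> assume "\<pi> \<in> couplings \<mu> \<nu>"
    from mult_left_mono[OF bound[OF this, folded C_def], of "ennreal (1 / C)"]
    show "ennreal (1 / C) * ?W \<le> ?c \<pi>" unfolding inv by simp
  qed
  from mult_left_mono[OF this, of "ennreal C"] inv[of ?W]
  show ?thesis by (simp add: C_def mult_ac)
qed

lemma wasserstein2_le:
  assumes le: "transport_cost2 \<mu>' \<nu>' \<le> ennreal C * transport_cost2 \<mu> \<nu>" and C: "C > 0" "C \<le> D\<^sup>2" "D > 0"
  shows "wasserstein2 \<mu>' \<nu>' \<le> ereal D * wasserstein2 \<mu> \<nu>"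
proof (cases "transport_cost2 \<mu> \<nu> = \<infinity>")
  case True
  \<comment> \<open>\<open>D > 0\<close> makes the right-hand side infinite; in
    \<open>ereal\<close>, zero times infinity is zero.\<close>
  then show ?thesis using C by (simp add: wasserstein2_def)
next
  case False
  then obtain w where w: "transport_cost2 \<mu> \<nu> = ennreal w" "w \<ge> 0"
    by (cases "transport_cost2 \<mu> \<nu>") auto
  then have le': "transport_cost2 \<mu>' \<nu>' \<le> ennreal (C * w)" using le C by (simp add: ennreal_mult)
  then obtain w' where w': "transport_cost2 \<mu>' \<nu>' = ennreal w'" "w' \<ge> 0"
    by (cases "transport_cost2 \<mu>' \<nu>'") (auto simp: top_unique)
  have "w' \<le> C * w" using le' w w' C by (simp add: ennreal_le_iff)
  also have "\<dots> \<le> D\<^sup>2 * w" using C w by (intro mult_right_mono)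
  finally have "sqrt w' \<le> sqrt (D\<^sup>2 * w)" by simp
  also have "\<dots> = D * sqrt w" using C by (simp add: real_sqrt_mult)
  finally show ?thesis using w w' by (simp add: wasserstein2_def)
qed

section \<open>Choice of constants and the contraction theorem\<close>

theorem corollary2p3:
  fixes b :: "real ^ 'd \<Rightarrow> real ^ 'd"
    and L\<^sub>b R c K :: real
  assumes "L\<^sub>b > 0" and "L\<^sub>b-lipschitz_on UNIV b"
    and "R > 0" and "c > 0" and "K > 0"
    and "\<And>x y. (x - y) \<bullet> (b x - b y) \<le>
           (if norm x \<ge> R \<or> norm y \<ge> R then - c * (norm (x - y))\<^sup>2
            else K * (norm (x - y))\<^sup>2)"
  shows "\<exists>(h::real) (\<delta>\<^sub>0::real) (T\<^sub>0::real) (M::real).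
           h > 0 \<and> \<delta>\<^sub>0 > 0 \<and> T\<^sub>0 > 0 \<and> M \<ge> 1 \<and>
           (\<forall>\<delta> T. 0 < \<delta> \<and> \<delta> \<le> \<delta>\<^sub>0 \<and> T \<ge> T\<^sub>0 \<longrightarrow>
             (\<forall>k::nat. k \<ge> 1 \<longrightarrow>
               (\<forall>\<mu> \<in> space (prob_algebra borel). \<forall>\<nu> \<in> space (prob_algebra borel).
                  wasserstein2 (kernel_iter \<mu> (euler_kernel b T \<delta>) k)
                               (kernel_iter \<nu> (euler_kernel b T \<delta>) k)
                    \<le> ereal (M * (1 - h * \<delta>) ^ k) * wasserstein2 \<mu> \<nu>)))"
proof -
  note L = assms(1) and R = assms(3) and c = assms(4) and K = assms(5)
  define \<beta> where "\<beta> = norm (b 0)"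
  \<comment> \<open>In the ball the first bump removes at least
    \<open>A * exp (- 1) * \<delta>\<close>: the part \<open>c / 2\<close> pays for drift and tail,
    the rest is the required drop, doubled because \<open>V \<le> 2\<close>. \<open>N\<close> keeps
    the tail below \<open>c / 4 * \<delta>\<close>. The bound
    \<open>a * real n \<le> \<kappa>\<close> gives \<open>V \<le> 2\<close> and a drift cost of at
    most \<open>c / 4 * \<delta>\<close>; \<open>T\<^sub>0\<close> secures half of it.\<close>
  define A where "A = exp 1 * (c / 2 + 2 * (2 * K + 1 + c))"
  define N where "N = max 1 (4 * A / c)"
  define C where "C = 2 * (2 * L\<^sub>b + 1) + \<beta>\<^sup>2 / (2 * R\<^sup>2)"
  define \<kappa> where "\<kappa> = min 1 (c / (4 * C))"
  define T\<^sub>0 where "T\<^sub>0 = 2 * A * N\<^sup>2 * R\<^sup>2 / \<kappa>"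
  \<comment> \<open>In order, the entries give: the smallness in the drift estimate; a displacement
    of at most \<open>R\<close> in the ball; the second-order term at most
    \<open>c / 2 * \<delta>\<close>, and at most \<open>\<delta>\<close>;
    \<open>\<theta> > 0\<close>; \<open>U \<ge> 0\<close> in the ball; the other half of
    \<open>a * real n \<le> \<kappa>\<close>.\<close>
  define \<delta>\<^sub>0 where "\<delta>\<^sub>0 = Min {1 / (2 * (2 * L\<^sub>b + 1)), R / (L\<^sub>b * R + \<beta>), c / (2 * L\<^sub>b\<^sup>2), 1 / L\<^sub>b\<^sup>2,
      1 / (2 * c), 1 / (2 * K + 1 + c), \<kappa> / (2 * A)}"
  have \<beta>: "\<beta> \<ge> 0" by (simp add: \<beta>_def)
  have A: "A > 0" using c K by (simp add: A_def)
  have N: "N \<ge> 1" "A / N \<le> c / 4"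
  proof -
    show "N \<ge> 1" by (simp add: N_def)
    moreover have "4 * A / c \<le> N" by (simp add: N_def)
    ultimately show "A / N \<le> c / 4" using c by (simp add: field_simps)
  qed
  have C: "C > 0" using L by (auto simp: C_def intro!: add_pos_nonneg)
  have \<kappa>: "\<kappa> > 0" "\<kappa> \<le> 1" "\<kappa> * C \<le> c / 4"
  proof -
    have "\<kappa> \<le> c / (4 * C)" by (simp add: \<kappa>_def)
    then show "\<kappa> * C \<le> c / 4" using C by (simp add: field_simps)
  qed (use c C in \<open>auto simp: \<kappa>_def\<close>)
  have LR: "L\<^sub>b * R + \<beta> > 0" using L R \<beta> by (intro add_pos_nonneg) auto
  have \<delta>\<^sub>0: "\<delta>\<^sub>0 > 0" unfolding \<delta>\<^sub>0_def using L R c K LR \<kappa> A by simp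
  have T\<^sub>0: "T\<^sub>0 > 0" using A N R \<kappa> by (simp add: T\<^sub>0_def)
  have [measurable]: "b \<in> borel_measurable borel"
    using lipschitz_on_continuous_on[OF assms(2)] by (rule borel_measurable_continuous_onI)
  have lip: "norm (b x - b y) \<le> L\<^sub>b * norm (x - y)" for x y
    using lipschitz_onD[OF assms(2), of x y] by (simp add: dist_norm)
  have main: "wasserstein2 (kernel_iter \<mu> (euler_kernel b T \<delta>) k) (kernel_iter \<nu> (euler_kernel b T \<delta>) k)
      \<le> ereal (2 * (1 - c / 2 * \<delta>) ^ k) * wasserstein2 \<mu> \<nu>"
    if \<delta>: "0 < \<delta>" "\<delta> \<le> \<delta>\<^sub>0" and T: "T \<ge> T\<^sub>0" for \<delta> T k and \<mu> \<nu> :: "(real ^ 'd) measure"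
  proof -
    have "\<delta>\<^sub>0 \<le> 1 / (2 * (2 * L\<^sub>b + 1))" "\<delta>\<^sub>0 \<le> R / (L\<^sub>b * R + \<beta>)" "\<delta>\<^sub>0 \<le> c / (2 * L\<^sub>b\<^sup>2)" "\<delta>\<^sub>0 \<le> 1 / L\<^sub>b\<^sup>2"
      "\<delta>\<^sub>0 \<le> 1 / (2 * c)" "\<delta>\<^sub>0 \<le> 1 / (2 * K + 1 + c)" "\<delta>\<^sub>0 \<le> \<kappa> / (2 * A)"
      unfolding \<delta>\<^sub>0_def by (rule Min_le, simp, blast)+
    note this[THEN order_trans[OF \<delta>(2)]]
    moreover have "2 * (2 * L\<^sub>b + 1) > 0" "2 * L\<^sub>b\<^sup>2 > 0" "L\<^sub>b\<^sup>2 > 0" "2 * c > 0" "2 * K + 1 + c > 0" "2 * A > 0"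
      using L c K A by simp_all
    ultimately have "\<delta> * (2 * (2 * L\<^sub>b + 1)) \<le> 1" "\<delta> * (L\<^sub>b * R + \<beta>) \<le> R" "\<delta> * (2 * L\<^sub>b\<^sup>2) \<le> c" "\<delta> * L\<^sub>b\<^sup>2 \<le> 1"
      "\<delta> * (2 * c) \<le> 1" "\<delta> * (2 * K + 1 + c) \<le> 1" "\<delta> * (2 * A) \<le> \<kappa>"
      using LR by (simp_all only: pos_le_divide_eq)
    then have "(2 * L\<^sub>b + 1) * \<delta> \<le> 1 / 2" "\<delta> * (L\<^sub>b * R + \<beta>) \<le> R" "\<delta> * L\<^sub>b\<^sup>2 \<le> c / 2" "\<delta> * L\<^sub>b\<^sup>2 \<le> 1"
      "c * \<delta> \<le> 1 / 2" "(2 * K + 1 + c) * \<delta> \<le> 1" "A * \<delta> \<le> \<kappa> / 2"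
      by (simp_all add: mult.commute mult.left_commute)
    note \<delta>_le = this
    define \<tau> where "\<tau> = T * \<delta>"
    have T_pos: "T > 0" using T T\<^sub>0 by simp
    then have \<tau>: "\<tau> > 0" using \<delta> by (simp add: \<tau>_def)
    \<comment> \<open>The time of the last bump must reach \<open>N\<^sup>2 * R\<^sup>2\<close>.
      Rounding up adds at most \<open>a = A * \<delta>\<close> to \<open>a * real n\<close>.\<close>
    define n where "n = nat \<lceil>N\<^sup>2 * R\<^sup>2 / \<tau>\<rceil>"
    have "N\<^sup>2 * R\<^sup>2 / \<tau> \<ge> 0" using \<tau> by simp
    then have n: "real n \<ge> N\<^sup>2 * R\<^sup>2 / \<tau>" "real n \<le> N\<^sup>2 * R\<^sup>2 / \<tau> + 1" unfolding n_def by linarith+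
    then have n\<tau>: "real n * \<tau> \<ge> N\<^sup>2 * R\<^sup>2" using \<tau> by (simp add: field_simps)
    define a where "a = A * \<delta>"
    have a: "a > 0" using A \<delta> by (simp add: a_def)
    have an: "a * real n \<le> \<kappa>"
    proof -
      have "a * real n \<le> a * (N\<^sup>2 * R\<^sup>2 / \<tau> + 1)" using n a by (intro mult_left_mono) auto
      also have "\<dots> = A * N\<^sup>2 * R\<^sup>2 / T + A * \<delta>"
        using \<delta> T_pos by (simp add: a_def \<tau>_def field_simps)
      also have "A * N\<^sup>2 * R\<^sup>2 / T \<le> \<kappa> / 2"
        using T T_pos \<kappa> by (simp add: T\<^sub>0_def field_simps)
      finally show ?thesis using \<delta>_le by simp
    qed
    define V where "V = (weight a R \<tau> n :: real ^ 'd \<Rightarrow> real)"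
    have V: "1 \<le> V x" "V x \<le> 2" for x
      using weight_bounds[of a R \<tau> n x] a R \<tau> an \<kappa> by (auto simp: V_def)
    define \<theta> where "\<theta> = 1 - c * \<delta>"
    have \<theta>: "\<theta> > 0" using \<delta>_le by (simp add: \<theta>_def)
    have step: "(\<integral>\<^sup>+z. ennreal (V (euler_map b T \<delta> x z)) \<partial>std_normal)
        * ennreal ((norm (x + \<delta> *\<^sub>R b x - (y + \<delta> *\<^sub>R b y)))\<^sup>2)
      \<le> ennreal \<theta> * (ennreal (V x) * ennreal ((norm (x - y))\<^sup>2))" for x y
    proof -
      define m where "m = x + \<delta> *\<^sub>R b x"
      define q where "q = V m - a * gauss R (R\<^sup>2) m + a * gauss R (R\<^sup>2 + real n * \<tau>) m"
      \<comment> \<open>\<open>g\<close> will bound the growth of the squared distance and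
        \<open>U\<close> the expected weight. Both look at \<open>x\<close> only: for
        \<open>norm x \<ge> R\<close> the contraction holds for every \<open>y\<close>, otherwise
        the rate \<open>K\<close> covers both cases.\<close>
      define g where "g = (if norm x < R then 1 + (2 * K + 1) * \<delta> else 1 - 3 / 2 * c * \<delta>)"
      define U where "U = (if norm x < R then 1 - (2 * K + 1 + c) * \<delta> else 1 + c / 2 * \<delta>) * V x"
      have "norm (b x) \<le> L\<^sub>b * norm x + \<beta>"
        using lip[of x 0] norm_triangle_ineq[of "b x - b 0" "b 0"] by (simp add: \<beta>_def)
      then have m: "norm (m - x) \<le> \<delta> * (L\<^sub>b * norm x + \<beta>)"
        using \<delta> by (simp add: m_def mult_left_mono)
      have "(\<integral>\<^sup>+z. ennreal (V (euler_map b T \<delta> x z)) \<partial>std_normal) = ennreal q"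
        using nn_integral_weight_std_normal[of a R \<tau> "sqrt (2 * T * \<delta>)" n m] a R \<tau> \<delta> T_pos
        by (simp add: V_def q_def m_def euler_map_def \<tau>_def)
      also have "q \<le> U"
      proof -
        have "q \<le> V x + a * real n * (C * \<delta>) + a / N - (if norm x < R then a * exp (- 1) else 0)"
          unfolding q_def V_def C_def
          by (rule weight_step_bound) (use R \<delta> \<delta>_le L \<beta> m a \<tau> N n\<tau> in auto)
        also have "a * real n * (C * \<delta>) \<le> c / 4 * \<delta>"
        proof -
          have "a * real n * (C * \<delta>) \<le> \<kappa> * (C * \<delta>)"
            using an C \<delta> by (intro mult_right_mono) auto
          also have "\<dots> \<le> c / 4 * \<delta>" using \<kappa>(3) \<delta> by (simp add: mult.assoc[symmetric] mult_right_mono)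
          finally show ?thesis .
        qed
        also have "a / N \<le> c / 4 * \<delta>"
          using mult_right_mono[OF N(2), of \<delta>] \<delta> by (simp add: a_def)
        also have "(if norm x < R then a * exp (- 1) else 0)
            = (if norm x < R then (c / 2 + 2 * (2 * K + 1 + c)) * \<delta> else 0)"
          by (simp add: a_def A_def exp_minus)
        finally have q: "q \<le> V x + c / 4 * \<delta> + c / 4 * \<delta>
            - (if norm x < R then (c / 2 + 2 * (2 * K + 1 + c)) * \<delta> else 0)" by simp
        show ?thesis
        proof (cases "norm x < R")
          case True
          \<comment> \<open>\<open>V \<le> 2\<close> turns the additive loss into a factor; in the
            other case \<open>V \<ge> 1\<close> does so for the additive gain.\<close>
          have "(2 * K + 1 + c) * \<delta> * V x \<le> (2 * K + 1 + c) * \<delta> * 2"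
            using V K c \<delta> by (intro mult_left_mono) auto
          then show ?thesis using q True by (simp add: U_def algebra_simps)
        next
          case False
          have "c / 2 * \<delta> * 1 \<le> c / 2 * \<delta> * V x" using V c \<delta> by (intro mult_left_mono) auto
          then show ?thesis using q False by (simp add: U_def algebra_simps)
        qed
      qed
      finally have int_le: "(\<integral>\<^sup>+z. ennreal (V (euler_map b T \<delta> x z)) \<partial>std_normal) \<le> ennreal U"
        by (simp add: ennreal_leI)
      \<comment> \<open>The sign allows the two \<open>ennreal\<close> factors to be merged into one
        below.\<close>
      have U0: "U \<ge> 0"
        unfolding U_def using V[of x] \<delta> \<delta>_le c by (intro mult_nonneg_nonneg) auto
      have dist_le: "(norm (x + \<delta> *\<^sub>R b x - (y + \<delta> *\<^sub>R b y)))\<^sup>2 \<le> g * (norm (x - y))\<^sup>2"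
      proof -
        let ?D = "(norm (x - y))\<^sup>2"
        have "x + \<delta> *\<^sub>R b x - (y + \<delta> *\<^sub>R b y) = (x - y) + \<delta> *\<^sub>R (b x - b y)"
          by (simp add: algebra_simps)
        then have "(norm (x + \<delta> *\<^sub>R b x - (y + \<delta> *\<^sub>R b y)))\<^sup>2
            = ?D + 2 * \<delta> * ((x - y) \<bullet> (b x - b y)) + \<delta> * (\<delta> * (norm (b x - b y))\<^sup>2)"
          by (simp only: power2_norm_eq_inner)
             (simp add: inner_add_left inner_add_right inner_commute algebra_simps)
        also have "(norm (b x - b y))\<^sup>2 \<le> L\<^sub>b\<^sup>2 * ?D"
          using power_mono[OF lip[of x y], of 2] by (simp add: power_mult_distrib)
        also have "(x - y) \<bullet> (b x - b y) \<le> (if norm x < R then K else - c) * ?D"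
        proof -
          have "- (c * ?D) \<le> K * ?D" using c K by (simp add: mult_nonneg_nonneg order_trans[of _ 0])
          then show ?thesis using assms(6)[of x y] by (auto split: if_splits)
        qed
        finally have "(norm (x + \<delta> *\<^sub>R b x - (y + \<delta> *\<^sub>R b y)))\<^sup>2
            \<le> ?D + 2 * \<delta> * ((if norm x < R then K else - c) * ?D) + \<delta> * (\<delta> * (L\<^sub>b\<^sup>2 * ?D))"
          using \<delta> by simp
        also have "\<dots> = (1 + 2 * \<delta> * (if norm x < R then K else - c) + \<delta> * (\<delta> * L\<^sub>b\<^sup>2)) * ?D"
          by (simp add: algebra_simps)
        \<comment> \<open>The second-order term turns the rate \<open>2 * K\<close> into
          \<open>2 * K + 1\<close> inside and \<open>2 * c\<close> into \<open>3 / 2 * c\<close>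
          outside.\<close>
        also have "\<dots> \<le> g * ?D"
          using mult_left_mono[OF \<delta>_le(3), of \<delta>] mult_left_mono[OF \<delta>_le(4), of \<delta>] \<delta>
          by (intro mult_right_mono) (auto simp: g_def algebra_simps)
        finally show ?thesis .
      qed
      have gU: "g * U \<le> \<theta> * V x"
      proof -
        \<comment> \<open>In both cases the terms linear in \<delta> add up to
          \<open>- c * \<delta>\<close>, and the quadratic term is at most 0.\<close>
        have "(2 * K + 1) * \<delta> * ((2 * K + 1 + c) * \<delta>) \<ge> 0" and "3 / 2 * c * \<delta> * (c / 2 * \<delta>) \<ge> 0"
          using K c \<delta> by (auto intro!: mult_nonneg_nonneg)
        then have "(if norm x < R then (1 + (2 * K + 1) * \<delta>) * (1 - (2 * K + 1 + c) * \<delta>)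
            else (1 - 3 / 2 * c * \<delta>) * (1 + c / 2 * \<delta>)) \<le> \<theta>"
          by (simp add: \<theta>_def algebra_simps)
        from mult_right_mono[OF this, of "V x"] V(1)[of x] show ?thesis
          by (simp add: g_def U_def mult.assoc split: if_splits)
      qed
      have "(\<integral>\<^sup>+z. ennreal (V (euler_map b T \<delta> x z)) \<partial>std_normal)
          * ennreal ((norm (x + \<delta> *\<^sub>R b x - (y + \<delta> *\<^sub>R b y)))\<^sup>2)
          \<le> ennreal U * ennreal (g * (norm (x - y))\<^sup>2)"
        by (intro mult_mono int_le ennreal_leI dist_le) auto
      also have "\<dots> = ennreal (g * U * (norm (x - y))\<^sup>2)"
        using U0 by (simp add: ennreal_mult'[symmetric] mult_ac)
      also have "\<dots> \<le> ennreal (\<theta> * V x * (norm (x - y))\<^sup>2)"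
        using gU by (intro ennreal_leI mult_right_mono) auto
      also have "\<dots> = ennreal \<theta> * (ennreal (V x) * ennreal ((norm (x - y))\<^sup>2))"
        using \<theta> order_trans[OF zero_le_one V(1)[of x]] by (simp add: ennreal_mult mult.assoc)
      finally show ?thesis .
    qed
    have half: "0 < 1 - c / 2 * \<delta>" using \<delta>_le by simp
    \<comment> \<open>Taking square roots halves the rate, hence \<open>h = c / 2\<close>; the
      weight bound 2 is below the square of \<open>M = 2\<close>.\<close>
    have "\<theta> \<le> (1 - c / 2 * \<delta>)\<^sup>2"
      using zero_le_power2[of "c / 2 * \<delta>"] by (simp add: \<theta>_def power2_eq_square algebra_simps)
    then have "\<theta> ^ k \<le> ((1 - c / 2 * \<delta>)\<^sup>2) ^ k" using \<theta> by (intro power_mono) auto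
    then have "2 * \<theta> ^ k \<le> 4 * ((1 - c / 2 * \<delta>)\<^sup>2) ^ k" using \<theta> zero_le_power[of \<theta> k] by linarith
    then have "2 * \<theta> ^ k \<le> (2 * (1 - c / 2 * \<delta>) ^ k)\<^sup>2"
      by (simp add: power_mult_distrib power_even_eq flip: power_mult)
    moreover have "V \<in> borel_measurable borel" by (simp add: V_def)
    ultimately show ?thesis
      using \<theta> half
      by (intro wasserstein2_le[of _ _ "2 * \<theta> ^ k"] transport_cost2_iter_le[where V = V] V step) auto
  qed
  show ?thesis
    by (rule exI[of _ "c / 2"], rule exI[of _ \<delta>\<^sub>0], rule exI[of _ T\<^sub>0], rule exI[of _ 2])
       (use c \<delta>\<^sub>0 T\<^sub>0 main in auto)
qed

end
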